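(* (1) For $n\ge 0$ let $S_n$ be the star graph on $n+1$ vertices (a central vertex adjacent to $n$ leaves). Then $\hom(S_q,S_n)=n^q+n$ for $q\ge1$, and this family of polynomials in $n$ (indexed by $q\ge 1$) is a two-level polynomial of degree function $q$ and depth exactly $q-2$. (2) For $q\ge1$, $\hom(K_q,K_{n^2}\sqcup K_n)=(n^2)_q+(n)_q$, where $K_m$ is the complete graph on $m$ vertices, $\sqcup$ is disjoint union, and $(x)_q=x(x-1)\cdots(x-q+1)$. This family of polynomials in $n$ (indexed by $q\ge1$) is a two-level polynomial of degree function $2q$ and depth exactly $q-1$. Here "depth exactly $e(q)$" means that $e$ is a valid depth function, and any valid depth function $e'$ with $e'(q)\ge e(q)$ for all $q\ge1$ satisfies $e'=e$.
   Context: Graphs are finite and simple; $\hom(F,G)$ denotes the number of graph homomorphisms from $F$ to $G$. Two-level polynomial (index set $q\ge1$): let $g$ be a polynomial taking nonnegative integer values at integers $q\ge 1$, and let $e:\{1,2,\dots\}\to\mathbb N\cup\{-1,\infty\}$. A sequence of polynomials $\{f_q(n)\}_{q\ge1}$, with $f_q$ of degree $g(q)$, is a two-level polynomial of degree function $g$ and depth function $e$ if, writing $f_q(n)=\sum_{r=0}^\infty c_r(q)n^{g(q)-r}$ with $c_r(q)=0$ for $r>g(q)$, there exist polynomials $\{\varphi_r(q)\}_{r\ge0}$ such that $c_r(q)=\varphi_r(q)$ for every $q\ge1$ and every $r\le e(q)$; such an $e$ is called a valid depth function. *)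

theory Defs
  imports
    "Graph_Theory.Pair_Digraph"
    "HOL-Computational_Algebra.Polynomial"
    "HOL-Library.Extended_Real"
    "HOL-Library.FuncSet"
begin

section \<open>Graphs and homomorphism numbers\<close>

text \<open>
  A finite simple graph is a \<^locale>\<open>pair_graph\<close>: an edge \<open>uv\<close> is represented by the two
  arcs \<open>(u, v)\<close> and \<open>(v, u)\<close>. The graphs below are shown to satisfy this locale.
\<close>

definition graph_homs :: "'a pair_pre_digraph \<Rightarrow> 'b pair_pre_digraph \<Rightarrow> ('a \<Rightarrow> 'b) set" where
  "graph_homs F G =
    {h \<in> pverts F \<rightarrow>\<^sub>E pverts G. \<forall>(u, v) \<in> parcs F. (h u, h v) \<in> parcs G}"

definition hom_count :: "'a pair_pre_digraph \<Rightarrow> 'b pair_pre_digraph \<Rightarrow> nat" where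
  "hom_count F G = card (graph_homs F G)"

text \<open>The centre of the star is \<open>0\<close>, the \<open>n\<close> leaves are \<open>1, \<dots>, n\<close>.\<close>

definition star_graph :: "nat \<Rightarrow> nat pair_pre_digraph" where
  "star_graph n = \<lparr> pverts = {0..n}, parcs = ({0} \<times> {1..n}) \<union> ({1..n} \<times> {0}) \<rparr>"

definition complete_graph :: "nat \<Rightarrow> nat pair_pre_digraph" where
  "complete_graph m = \<lparr> pverts = {..<m}, parcs = {(u, v). u < m \<and> v < m \<and> u \<noteq> v} \<rparr>"

definition disjoint_union ::
  "'a pair_pre_digraph \<Rightarrow> 'b pair_pre_digraph \<Rightarrow> ('a + 'b) pair_pre_digraph" where
  "disjoint_union G H =
    \<lparr> pverts = pverts G <+> pverts H,
      parcs = map_prod Inl Inl ` parcs G \<union> map_prod Inr Inr ` parcs H \<rparr>"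

lemma pair_graph_star_graph: "pair_graph (star_graph n)"
  by unfold_locales (auto simp: star_graph_def symmetric_def sym_def)

lemma pair_graph_complete_graph: "pair_graph (complete_graph m)"
proof -
  have "finite {(u, v). u < m \<and> v < m \<and> u \<noteq> v}"
    by (rule finite_subset[of _ "{..<m} \<times> {..<m}"]) auto
  then show ?thesis
    by unfold_locales (auto simp: complete_graph_def symmetric_def sym_def)
qed

lemma pair_graph_disjoint_union:
  assumes "pair_graph G" "pair_graph H"
  shows "pair_graph (disjoint_union G H)"
proof -
  interpret G: pair_graph G by fact
  interpret H: pair_graph H by fact
  show ?thesis
    using G.in_arcsD1 G.in_arcsD2 H.in_arcsD1 H.in_arcsD2 G.no_loops' H.no_loops'
      G.arcs_symmetric H.arcs_symmetric
    by unfold_locales (fastforce simp: disjoint_union_def symmetric_def sym_def)+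
qed


section \<open>Two-level polynomials\<close>

text \<open>
  Polynomials have real coefficients. Families and degree/depth functions are indexed by
  \<open>q \<ge> 1\<close>: although they have domain \<^typ>\<open>nat\<close>, their values at \<open>0\<close> play no role.
\<close>

text \<open>
  The coefficient \<open>c\<^sub>r\<close> in \<open>\<Sum>r. c\<^sub>r n\<^bsup>d - r\<^esup>\<close>, with \<open>c\<^sub>r = 0\<close> for \<open>r > d\<close>; the
  case distinction is needed because natural subtraction truncates.
\<close>

definition codegree_coeff :: "nat \<Rightarrow> real poly \<Rightarrow> nat \<Rightarrow> real" where
  "codegree_coeff d p r = (if r \<le> d then coeff p (d - r) else 0)"

definition depth_values :: "ereal set" where
  "depth_values = range (\<lambda>k::nat. ereal (real k)) \<union> {-1, \<infinity>}"

text \<open>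
  The condition \<open>f q \<noteq> 0\<close> excludes the convention that the zero polynomial has degree \<open>0\<close>.
\<close>

definition two_level_polynomial ::
  "(nat \<Rightarrow> real poly) \<Rightarrow> real poly \<Rightarrow> (nat \<Rightarrow> ereal) \<Rightarrow> bool" where
  "two_level_polynomial f g e \<longleftrightarrow>
    (\<forall>q\<ge>1. poly g (real q) \<in> \<nat>) \<and>
    (\<forall>q\<ge>1. e q \<in> depth_values) \<and>
    (\<forall>q\<ge>1. f q \<noteq> 0 \<and> real (degree (f q)) = poly g (real q)) \<and>
    (\<exists>\<phi> :: nat \<Rightarrow> real poly. \<forall>q\<ge>1. \<forall>r. ereal (real r) \<le> e q \<longrightarrow>
        codegree_coeff (degree (f q)) (f q) r = poly (\<phi> r) (real q))"

definition two_level_polynomial_exact ::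
  "(nat \<Rightarrow> real poly) \<Rightarrow> real poly \<Rightarrow> (nat \<Rightarrow> ereal) \<Rightarrow> bool" where
  "two_level_polynomial_exact f g e \<longleftrightarrow>
    two_level_polynomial f g e \<and>
    (\<forall>e'. two_level_polynomial f g e' \<and> (\<forall>q\<ge>1. e q \<le> e' q) \<longrightarrow> (\<forall>q\<ge>1. e' q = e q))"

definition falling_factorial :: "'a::comm_ring_1 \<Rightarrow> nat \<Rightarrow> 'a" where
  "falling_factorial x q = (\<Prod>i<q. x - of_nat i)"

end

theory Submission
  imports Defs
begin

section \<open>Homomorphism counts\<close>

text \<open>Each family is a dominant polynomial plus a lower one. The dominant part has
  coefficients polynomial in \<open>q\<close> at every fixed codegree: for \<open>n^q\<close> they
  are 1, 0, 0, ...; for \<open>(n^2)_q\<close> they vanish at odd codegree, and at codegree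
  \<open>2s\<close> they are the signed Stirling numbers of the first kind at
  \<open>(q, q - s)\<close>, polynomial in \<open>q\<close> by
  \<open>ex_poly_codegree_coeff_falling_factorial\<close>. The lower part, \<open>n\<close> or
  \<open>(n)_q\<close>, enters at codegree \<open>q - 1\<close> or \<open>q\<close> respectively,
  with coefficient 1. This gives validity up to the codegree just before. Since the polynomials
  \<open>\<phi> r\<close> are forced by their values at infinitely many \<open>q\<close>, no choice
  can absorb the extra 1, so the depth is exact (\<open>two_level_polynomial_exactI\<close>, with
  \<open>d = 1\<close> and \<open>d = 0\<close>). The counts hold because a homomorphism between
  stars is decided by the side to which the centre goes, and a homomorphism from \<open>K_q\<close>
  to a union of cliques is an injection into one of them.\<close>

lemma falling_factorial_Suc_shift:
  "falling_factorial x (Suc q) = x * falling_factorial (x - 1) q"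
  by (simp add: falling_factorial_def prod.lessThan_Suc_shift algebra_simps del: prod.lessThan_Suc)

text \<open>Once \<open>x\<close> is sent to \<open>y\<close>, the rest is an injection into
  \<open>T - {y}\<close>; hence the induction over \<open>S\<close> with \<open>T\<close> arbitrary.
  The count is cast to \<open>int\<close> because \<open>falling_factorial\<close> lives in a ring;
  a zero factor covers \<open>card T < card S\<close>.\<close>

lemma card_PiE_inj_on:
  assumes "finite S" "finite T"
  shows "int (card {h \<in> S \<rightarrow>\<^sub>E T. inj_on h S}) = falling_factorial (int (card T)) (card S)"
  using assms
proof (induction S arbitrary: T rule: finite_induct)
  case empty
  have "{h \<in> {} \<rightarrow>\<^sub>E T. inj_on h {}} = {\<lambda>x. undefined}" by auto
  then show ?case by (simp add: falling_factorial_def)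
next
  case (insert x S)
  let ?inj = "\<lambda>S T. {h \<in> S \<rightarrow>\<^sub>E T. inj_on h S}"
  have fin: "finite (?inj S T')" if "finite T'" for T'
    by (rule finite_subset[of _ "S \<rightarrow>\<^sub>E T'"]) (auto intro: finite_PiE insert.hyps that)
  have "{(y, g). y \<in> T \<and> g \<in> S \<rightarrow>\<^sub>E (T - {y}) \<and> inj_on g S} = (SIGMA y:T. ?inj S (T - {y}))"
    by auto
  then have "card (?inj (insert x S) T) = card (SIGMA y:T. ?inj S (T - {y}))"
    using extensional_funcset_extend_domain_inj_on_eq[OF insert.hyps(2), of T]
      extensional_funcset_extend_domain_inj_onI[OF insert.hyps(2), of T]
    by (simp add: card_image)
  also have "\<dots> = (\<Sum>y\<in>T. card (?inj S (T - {y})))"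
    using insert.prems fin by (intro card_SigmaI) auto
  also have "int \<dots> = (\<Sum>y\<in>T. int (card (?inj S (T - {y}))))"
    by simp
  also have "\<dots> = (\<Sum>y\<in>T. falling_factorial (int (card T) - 1) (card S))"
  proof (rule sum.cong)
    fix y assume "y \<in> T"
    with insert.prems have "card T = Suc (card (T - {y}))"
      by (metis card_Suc_Diff1)
    with insert.IH[of "T - {y}"] insert.prems
    show "int (card (?inj S (T - {y}))) = falling_factorial (int (card T) - 1) (card S)"
      by simp
  qed simp
  finally show ?case
    using insert.hyps by (simp add: falling_factorial_Suc_shift)
qed

lemma hom_count_star_graph:
  assumes "q \<ge> 1"
  shows "hom_count (star_graph q) (star_graph n) = n ^ q + n"
proof -
  \<comment> \<open>\<open>?A\<close> sends centre to centre and leaves to leaves; \<open>?B\<close>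
    sends the centre to a leaf, forcing every leaf to the centre. Written as dependent products,
    both are counted by \<open>card_PiE\<close>.\<close>
  let ?A = "PiE {0..q} (\<lambda>i. if i = 0 then {0} else {1..n})"
  let ?B = "PiE {0..q} (\<lambda>i. if i = 0 then {1..n} else {0})"
  have homs: "graph_homs (star_graph q) (star_graph n) = ?A \<union> ?B"
    (is "?H = _")
  proof (intro set_eqI iffI)
    fix h assume h: "h \<in> ?H"
    then have ext: "h \<in> extensional {0..q}"
      by (auto simp: graph_homs_def star_graph_def PiE_def)
    have arc: "(h 0 = 0 \<and> h i \<in> {1..n}) \<or> (h 0 \<in> {1..n} \<and> h i = 0)" if "i \<in> {1..q}" for i
    proof -
      have "(0, i) \<in> parcs (star_graph q)"
        using that by (simp add: star_graph_def)
      with h have "(h 0, h i) \<in> parcs (star_graph n)"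
        unfolding graph_homs_def by blast
      then show ?thesis by (auto simp: star_graph_def)
    qed
    from arc[of 1] assms consider "h 0 = 0" | "h 0 \<in> {1..n}" by auto
    then show "h \<in> ?A \<union> ?B"
    proof cases
      case 1
      have "h i \<in> {1..n}" if "i \<in> {0..q}" "i \<noteq> 0" for i
        using arc[of i] that 1 by auto
      with 1 ext show ?thesis by (auto simp: PiE_def Pi_def)
    next
      case 2
      have "h i = 0" if "i \<in> {0..q}" "i \<noteq> 0" for i
        using arc[of i] that 2 by auto
      with 2 ext show ?thesis by (auto simp: PiE_def Pi_def)
    qed
  next
    fix h assume "h \<in> ?A \<union> ?B"
    then consider (A) "h \<in> ?A" | (B) "h \<in> ?B" by blast
    then show "h \<in> ?H"
    proof cases
      case A
      have "h 0 = 0" using PiE_mem[OF A, of 0] by simp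
      moreover have "h i \<in> {1..n}" if "i \<in> {1..q}" for i
        using PiE_mem[OF A, of i] that by simp
      moreover have "h i \<le> n" if "i \<le> q" for i
        using PiE_mem[OF A, of i] that by (simp split: if_splits)
      ultimately show ?thesis
        using A by (auto simp: graph_homs_def star_graph_def PiE_def)
    next
      case B
      have "h 0 \<in> {1..n}" using PiE_mem[OF B, of 0] by simp
      moreover have "h i = 0" if "i \<in> {1..q}" for i
        using PiE_mem[OF B, of i] that by simp
      moreover have "h i \<le> n" if "i \<le> q" for i
        using PiE_mem[OF B, of i] that by (simp split: if_splits)
      ultimately show ?thesis
        using B by (auto simp: graph_homs_def star_graph_def PiE_def)
    qed
  qed
  have "h 0 = 0" if "h \<in> ?A" for h
    using PiE_mem[OF that, of 0] by simp
  moreover have "h 0 \<noteq> 0" if "h \<in> ?B" for h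
    using PiE_mem[OF that, of 0] by simp
  ultimately have "?A \<inter> ?B = {}" by blast
  then have "card ?H = card ?A + card ?B"
    unfolding homs by (intro card_Un_disjoint finite_PiE) auto
  also have "{0..q} = insert 0 {1..q}" by auto
  also have "card (PiE (insert 0 {1..q}) (\<lambda>i. if i = 0 then {0} else {1..n})) = n ^ q"
    by (simp add: card_PiE)
  also have "card (PiE (insert 0 {1..q}) (\<lambda>i. if i = 0 then {1..n} else {0})) = n"
    by (simp add: card_PiE)
  finally show ?thesis
    by (simp add: hom_count_def)
qed

text \<open>Any two vertices of a clique are adjacent, so their images are distinct and in the same
  component. Vertex 0, present since \<open>q \<ge> 1\<close>, selects the component and keeps the
  two families of injections disjoint; at \<open>q = 0\<close> they would share the empty
  map.\<close>

lemma hom_count_complete_graph_disjoint_union: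
  assumes "q \<ge> 1"
  shows "int (hom_count (complete_graph q) (disjoint_union (complete_graph m) (complete_graph n))) =
    falling_factorial (int m) q + falling_factorial (int n) q"
proof -
  define inj_maps :: "(nat + nat) set \<Rightarrow> (nat \<Rightarrow> nat + nat) set" where
    "inj_maps T = {h \<in> {..<q} \<rightarrow>\<^sub>E T. inj_on h {..<q}}" for T
  let ?A = "inj_maps (Inl ` {..<m})" and ?B = "inj_maps (Inr ` {..<n})"
  let ?G = "disjoint_union (complete_graph m) (complete_graph n)"
  have arcs: "(u, v) \<in> parcs ?G \<longleftrightarrow>
      u \<noteq> v \<and> ((u \<in> Inl ` {..<m} \<and> v \<in> Inl ` {..<m}) \<or> (u \<in> Inr ` {..<n} \<and> v \<in> Inr ` {..<n}))"
    for u v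
    by (cases u; cases v) (auto simp: disjoint_union_def complete_graph_def map_prod_def image_iff)
  have homs: "graph_homs (complete_graph q) ?G = ?A \<union> ?B" (is "?H = _")
  proof (intro set_eqI iffI)
    fix h assume h: "h \<in> ?H"
    then have ext: "h \<in> extensional {..<q}"
      and mem: "\<And>i. i < q \<Longrightarrow> h i \<in> Inl ` {..<m} \<union> Inr ` {..<n}"
      by (auto simp: graph_homs_def complete_graph_def disjoint_union_def PiE_def Pi_def Plus_def)
    have arc: "(h i, h j) \<in> parcs ?G" if "i < q" "j < q" "i \<noteq> j" for i j
      using h that by (auto simp: graph_homs_def complete_graph_def)
    have inj: "inj_on h {..<q}"
      using arc by (auto simp: inj_on_def arcs)
    from mem[of 0] assms consider "h 0 \<in> Inl ` {..<m}" | "h 0 \<in> Inr ` {..<n}" by auto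
    then show "h \<in> ?A \<union> ?B"
    proof cases
      case 1
      then have "h i \<in> Inl ` {..<m}" if "i < q" for i
        using arc[of 0 i] that assms unfolding arcs by (cases "i = 0") auto
      then show ?thesis
        using ext inj unfolding inj_maps_def by (auto simp: PiE_def Pi_def)
    next
      case 2
      then have "h i \<in> Inr ` {..<n}" if "i < q" for i
        using arc[of 0 i] that assms unfolding arcs by (cases "i = 0") auto
      then show ?thesis
        using ext inj unfolding inj_maps_def by (auto simp: PiE_def Pi_def)
    qed
  next
    fix h assume h: "h \<in> ?A \<union> ?B"
    then have arc: "(h i, h j) \<in> parcs ?G" if "i < q" "j < q" "i \<noteq> j" for i j
      using that unfolding arcs inj_maps_def by (auto simp: PiE_def Pi_def inj_on_def)
    have "h \<in> {..<q} \<rightarrow>\<^sub>E Inl ` {..<m} \<union> Inr ` {..<n}"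
      using h unfolding inj_maps_def by (auto simp: PiE_def Pi_def)
    then show "h \<in> ?H"
      using arc by (auto simp: graph_homs_def complete_graph_def disjoint_union_def Plus_def)
  qed
  have disj: "?A \<inter> ?B = {}"
    using assms by (force simp: inj_maps_def PiE_def Pi_def)
  have fin: "finite (inj_maps T)" if "finite T" for T
    unfolding inj_maps_def by (rule finite_subset[of _ "{..<q} \<rightarrow>\<^sub>E T"]) (auto intro: finite_PiE that)
  have "int (card ?H) = int (card ?A) + int (card ?B)"
    unfolding homs using disj by (simp add: card_Un_disjoint fin)
  also have "int (card ?A) = falling_factorial (int m) q"
    unfolding inj_maps_def by (subst card_PiE_inj_on) (auto simp: card_image)
  also have "int (card ?B) = falling_factorial (int n) q"
    unfolding inj_maps_def by (subst card_PiE_inj_on) (auto simp: card_image)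
  finally show ?thesis
    by (simp add: hom_count_def)
qed

section \<open>Coefficients of falling factorials\<close>

lemma falling_factorial_0 [simp]: "falling_factorial x 0 = 1"
  by (simp add: falling_factorial_def)

lemma falling_factorial_Suc:
  "falling_factorial x (Suc q) = (x - of_nat q) * falling_factorial x q"
  by (simp add: falling_factorial_def mult.commute)

lemma falling_factorial_X_degree:
  "degree (falling_factorial [:0, 1::real:] q) = q \<and> coeff (falling_factorial [:0, 1::real:] q) q = 1"
proof (induction q)
  case (Suc q)
  have X: "[:0, 1:] - of_nat q = [:- real q, 1:]"
    by (simp add: of_nat_poly)
  from Suc have "falling_factorial [:0, 1::real:] q \<noteq> 0" by auto
  with Suc have "degree (falling_factorial [:0, 1::real:] (Suc q)) = Suc q"
    unfolding falling_factorial_Suc X by (simp add: degree_mult_eq del: mult_pCons_left)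
  moreover have "coeff (falling_factorial [:0, 1::real:] (Suc q)) (Suc q) = 1"
    unfolding falling_factorial_Suc X using Suc by (simp add: coeff_eq_0)
  ultimately show ?case ..
qed simp

text \<open>The Stirling recurrence: in \<open>(x - q) (x)_q\<close>, multiplying by
  \<open>x\<close> preserves codegree relative to the new degree, while multiplying by the constant
  raises it by one.\<close>

lemma codegree_coeff_falling_factorial_Suc:
  "codegree_coeff (Suc q) (falling_factorial [:0, 1:] (Suc q)) (Suc s) =
    codegree_coeff q (falling_factorial [:0, 1:] q) (Suc s)
    - real q * codegree_coeff q (falling_factorial [:0, 1:] q) s"
proof -
  have ff: "falling_factorial [:0, 1::real:] (Suc q) =
      pCons 0 (falling_factorial [:0, 1:] q) - smult (real q) (falling_factorial [:0, 1:] q)"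
    by (simp add: falling_factorial_Suc of_nat_poly algebra_simps)
  show ?thesis
  proof (cases "s < q")
    case True
    then have "q - s = Suc (q - Suc s)" by simp
    with True ff show ?thesis by (simp add: codegree_coeff_def)
  \<comment> \<open>At \<open>s = q\<close> the constant coefficient of \<open>pCons 0\<close> is 0,
    matching the default value of \<open>codegree_coeff\<close>; for \<open>s > q\<close> every term
    is 0.\<close>
  qed (auto simp: ff codegree_coeff_def)
qed

section \<open>Polynomial antidifferences and the Stirling coefficients\<close>

text \<open>The difference of \<open>x^(n+1)\<close> is \<open>(n+1) x^n\<close> plus lower powers,
  whose antidifferences come from strong induction; \<open>Q\<close> subtracts these and divides by
  \<open>n + 1\<close>.\<close>

lemma ex_poly_diff_power:
  "\<exists>P :: real poly. \<forall>x. poly P (x + 1) - poly P x = x ^ n"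
proof (induction n rule: less_induct)
  case (less n)
  then obtain P :: "nat \<Rightarrow> real poly"
    where P: "\<And>k x. k < n \<Longrightarrow> poly (P k) (x + 1) - poly (P k) x = x ^ k"
    by metis
  define Q where
    "Q = smult (1 / real (Suc n)) (monom 1 (Suc n) - (\<Sum>k<n. smult (real (Suc n choose k)) (P k)))"
  have "poly Q (x + 1) - poly Q x = x ^ n" for x
  proof -
    have "(x + 1) ^ Suc n = (\<Sum>k\<le>Suc n. real (Suc n choose k) * x ^ k)"
      by (subst binomial_ring) simp
    also have "\<dots> = (\<Sum>k<n. real (Suc n choose k) * x ^ k) + real (Suc n) * x ^ n + x ^ Suc n"
      by (simp add: lessThan_Suc_atMost[symmetric])
    finally have binom: "(x + 1) ^ Suc n - x ^ Suc n - (\<Sum>k<n. real (Suc n choose k) * x ^ k)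
        = real (Suc n) * x ^ n"
      by simp
    have "(\<Sum>k<n. real (Suc n choose k) * x ^ k) =
        (\<Sum>k<n. real (Suc n choose k) * poly (P k) (x + 1))
        - (\<Sum>k<n. real (Suc n choose k) * poly (P k) x)"
      unfolding sum_subtractf[symmetric] by (intro sum.cong) (simp_all add: P[symmetric] algebra_simps)
    with binom have "real (Suc n) * (poly Q (x + 1) - poly Q x) = real (Suc n) * x ^ n"
      by (simp add: Q_def poly_monom poly_sum right_diff_distrib del: power_Suc of_nat_Suc)
    then show ?thesis by simp
  qed
  then show ?case by blast
qed

lemma ex_poly_diff:
  "\<exists>P :: real poly. \<forall>x. poly P (x + 1) - poly P x = poly p x"
proof -
  obtain P :: "nat \<Rightarrow> real poly"
    where P: "\<And>k x. poly (P k) (x + 1) - poly (P k) x = x ^ k"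
    using ex_poly_diff_power by metis
  have "poly (\<Sum>k\<le>degree p. smult (coeff p k) (P k)) (x + 1)
      - poly (\<Sum>k\<le>degree p. smult (coeff p k) (P k)) x = poly p x" for x
    unfolding poly_sum poly_smult sum_subtractf[symmetric] right_diff_distrib[symmetric] P poly_altdef[of p] ..
  then show ?thesis by blast
qed

text \<open>
  These are the signed Stirling numbers of the first kind at \<open>(q, q - s)\<close>; summing their recurrence
  over \<open>q\<close> keeps them polynomial in \<open>q\<close>.
\<close>

lemma ex_poly_codegree_coeff_falling_factorial:
  "\<exists>P. \<forall>q. codegree_coeff q (falling_factorial [:0, 1:] q) s = poly P (real q)"
proof (induction s)
  case 0
  have "codegree_coeff q (falling_factorial [:0, 1:] q) 0 = poly 1 (real q)" for q
    using falling_factorial_X_degree[of q] by (simp add: codegree_coeff_def)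
  then show ?case by blast
next
  case (Suc s)
  then obtain P where P: "\<And>q. codegree_coeff q (falling_factorial [:0, 1:] q) s = poly P (real q)"
    by blast
  \<comment> \<open>By the recurrence, the increment from \<open>q\<close> to \<open>q + 1\<close>
    is \<open>- q * poly P q\<close>.\<close>
  obtain Q where Q: "\<And>x. poly Q (x + 1) - poly Q x = poly ([:0, -1:] * P) x"
    using ex_poly_diff by blast
  \<comment> \<open>The constant normalises the antidifference to 0 at \<open>q = 0\<close>, where
    codegree \<open>Suc s\<close> exceeds the degree.\<close>
  have "codegree_coeff q (falling_factorial [:0, 1:] q) (Suc s) = poly (Q - [:poly Q 0:]) (real q)" for q
  proof (induction q)
    case 0
    show ?case by (simp add: codegree_coeff_def)
  next
    case (Suc q)
    then show ?case
      using Q[of "real q"] by (simp add: codegree_coeff_falling_factorial_Suc P add.commute)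
  qed
  then show ?case by blast
qed

section \<open>Substituting the square of the variable\<close>

lemma falling_factorial_X2:
  "falling_factorial ([:0, 1:] ^ 2) q = pcompose (falling_factorial [:0, 1::real:] q) [:0, 0, 1:]"
  by (simp add: falling_factorial_def pcompose_prod pcompose_diff of_nat_poly pcompose_pCons power2_eq_square)

lemma coeff_pcompose_X2:
  "coeff (pcompose p [:0, 0, 1:]) i = (if even i then coeff p (i div 2) else 0)"
  for p :: "'a::comm_ring_1 poly"
proof (induction p arbitrary: i)
  case (pCons a p)
  have "pcompose (pCons a p) [:0, 0, 1:] = pCons a (pCons 0 (pcompose p [:0, 0, 1:]))"
    by (simp add: pcompose_pCons)
  then show ?case
    by (auto simp: pCons.IH coeff_pCons split: nat.splits elim!: oddE)
qed simp

lemma codegree_coeff_falling_factorial_X2: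
  "codegree_coeff (2 * q) (falling_factorial ([:0, 1:] ^ 2) q) r =
    (if even r then codegree_coeff q (falling_factorial [:0, 1:] q) (r div 2) else 0)"
  unfolding falling_factorial_X2
  by (auto simp: codegree_coeff_def coeff_pcompose_X2 diff_mult_distrib2[symmetric] elim!: evenE)

section \<open>Exact depth\<close>

text \<open>
  For fixed \<open>r\<close>, any competing \<open>\<phi>'\<^sub>r\<close> agrees with \<open>\<phi>\<^sub>r\<close> at all large \<open>q\<close>, hence equals it. So depth
  cannot be increased at \<open>q\<close> once \<open>\<phi>\<^sub>r\<close> itself fails at the next index \<open>r = q - d\<close>.
\<close>

lemma two_level_polynomial_exactI:
  assumes "d \<le> 1"
    and deg: "\<And>q. q \<ge> 1 \<Longrightarrow> f q \<noteq> 0 \<and> real (degree (f q)) = poly g (real q)"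
    and valid: "\<And>q r. r + d < q \<Longrightarrow> codegree_coeff (degree (f q)) (f q) r = poly (\<phi> r) (real q)"
    and fail: "\<And>q. q \<ge> 1 \<Longrightarrow>
      codegree_coeff (degree (f q)) (f q) (q - d) \<noteq> poly (\<phi> (q - d)) (real q)"
  shows "two_level_polynomial_exact f g (\<lambda>q. ereal (real q - 1 - real d))"
  unfolding two_level_polynomial_exact_def
proof (intro conjI allI impI)
  have Nats: "poly g (real q) \<in> \<nat>" if "q \<ge> 1" for q
    using deg[OF that] by (metis of_nat_in_Nats)
  have depth: "ereal (real q - 1 - real d) \<in> depth_values" if "q \<ge> 1" for q
  proof (cases "q = d")
    \<comment> \<open>Here \<open>q = d = 1\<close>, and the depth takes the exceptional value
      -1.\<close>
    case True
    then show ?thesis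
      by (simp add: depth_values_def one_ereal_def)
  next
    case False
    with that \<open>d \<le> 1\<close> have nat: "real q - 1 - real d = real (q - 1 - d)" by auto
    show ?thesis
      unfolding nat depth_values_def by blast
  qed
  have le: "ereal (real r) \<le> ereal (real q - 1 - real d) \<longleftrightarrow> r + d < q" for r q
    by simp linarith
  show "two_level_polynomial f g (\<lambda>q. ereal (real q - 1 - real d))"
    unfolding two_level_polynomial_def le using Nats depth deg valid by blast
next
  fix e' :: "nat \<Rightarrow> ereal" and q :: nat
  assume e': "two_level_polynomial f g e' \<and> (\<forall>q\<ge>1. ereal (real q - 1 - real d) \<le> e' q)"
    and q: "1 \<le> q"
  from e' obtain \<phi>' where \<phi>': "\<And>q r. q \<ge> 1 \<Longrightarrow> ereal (real r) \<le> e' q \<Longrightarrow>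
      codegree_coeff (degree (f q)) (f q) r = poly (\<phi>' r) (real q)"
    unfolding two_level_polynomial_def by blast
  show "e' q = ereal (real q - 1 - real d)"
  proof (rule ccontr)
    assume "e' q \<noteq> ereal (real q - 1 - real d)"
    with e' q have gt: "ereal (real q - 1 - real d) < e' q" by (simp add: less_le)
    \<comment> \<open>Depth values are discrete, so exceeding \<open>q - 1 - d\<close> means
      reaching at least \<open>q - d\<close>; the value -1 is excluded because
      \<open>d \<le> q\<close>.\<close>
    moreover have "e' q \<in> depth_values"
      using e' q by (simp add: two_level_polynomial_def)
    moreover have "q - d \<le> k" if "real q - 1 - real d < real k" for k
      using that by linarith
    ultimately have le_next: "ereal (real (q - d)) \<le> e' q"
      using q \<open>d \<le> 1\<close> by (auto simp: depth_values_def one_ereal_def simp del: of_nat_diff)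
    define r where "r = q - d"
    have "poly (\<phi>' r) (real k) = poly (\<phi> r) (real k)" if "k > r + d" for k
    proof -
      have "ereal (real r) \<le> ereal (real k - 1 - real d)" using that by simp
      also have "\<dots> \<le> e' k" using e' that by simp
      finally show ?thesis using \<phi>'[of k r] valid[of r k] that by simp
    qed
    then have "real ` {r + d<..} \<subseteq> {x. poly (\<phi>' r - \<phi> r) x = 0}" by auto
    moreover have "infinite (real ` {r + d<..})"
      by (simp add: finite_image_iff infinite_Ioi)
    ultimately have "\<phi>' r - \<phi> r = 0"
      using poly_roots_finite finite_subset by blast
    then show False
      using \<phi>'[OF q le_next] fail[OF q] by (simp add: r_def)
  qed
qed

section \<open>The two families\<close>

lemma two_level_polynomial_exact_star:
  "two_level_polynomial_exact (\<lambda>q. [:0, 1:] ^ q + [:0, 1:]) [:0, 1:] (\<lambda>q. ereal (real q - 2))"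
proof -
  define f :: "nat \<Rightarrow> real poly" where "f q = [:0, 1:] ^ q + [:0, 1:]" for q
  define \<phi> :: "nat \<Rightarrow> real poly" where "\<phi> r = (if r = 0 then 1 else 0)" for r
  have f: "f q = monom 1 q + monom 1 1" for q
    by (simp add: f_def monom_altdef)
  have deg: "degree (f q) = q" if "q \<ge> 1" for q
  proof (rule antisym)
    show "degree (f q) \<le> q"
      unfolding f using that by (intro degree_add_le degree_monom_le[THEN order_trans]) auto
    show "q \<le> degree (f q)"
      by (rule le_degree) (auto simp: f)
  qed
  have "two_level_polynomial_exact f [:0, 1:] (\<lambda>q. ereal (real q - 1 - real 1))"
  proof (rule two_level_polynomial_exactI[where \<phi> = \<phi>])
    show "f q \<noteq> 0 \<and> real (degree (f q)) = poly [:0, 1:] (real q)" if "q \<ge> 1" for q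
      using deg[OF that] that by auto
    show "codegree_coeff (degree (f q)) (f q) r = poly (\<phi> r) (real q)" if "r + 1 < q" for q r
      using that by (simp add: deg) (auto simp: codegree_coeff_def f \<phi>_def)
    \<comment> \<open>For \<open>q > 1\<close> the summand \<open>n\<close> gives 1 against 0; for
      \<open>q = 1\<close> the polynomial is \<open>2n\<close>, giving 2 against 1.\<close>
    show "codegree_coeff (degree (f q)) (f q) (q - 1) \<noteq> poly (\<phi> (q - 1)) (real q)" if "q \<ge> 1" for q
      using that by (simp add: deg) (auto simp: codegree_coeff_def f \<phi>_def)
  qed simp
  then show ?thesis
    by (simp add: f_def[abs_def])
qed

lemma two_level_polynomial_exact_complete:
  "two_level_polynomial_exact
    (\<lambda>q. falling_factorial ([:0, 1:] ^ 2) q + falling_factorial [:0, 1:] q)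
    [:0, 2:] (\<lambda>q. ereal (real q - 1))"
proof -
  define F :: "nat \<Rightarrow> real poly" where "F = falling_factorial [:0, 1:]"
  define f :: "nat \<Rightarrow> real poly" where "f q = falling_factorial ([:0, 1:] ^ 2) q + F q" for q
  obtain P where P: "\<And>s q. codegree_coeff q (F q) s = poly (P s) (real q)"
    unfolding F_def using ex_poly_codegree_coeff_falling_factorial by metis
  define \<phi> :: "nat \<Rightarrow> real poly" where "\<phi> r = (if even r then P (r div 2) else 0)" for r
  have F: "degree (F q) = q" "coeff (F q) q = 1" for q
    using falling_factorial_X_degree[of q] by (auto simp: F_def)
  have deg: "degree (f q) = 2 * q" if "q \<ge> 1" for q
  proof (rule antisym)
    show "degree (f q) \<le> 2 * q"
      unfolding f_def falling_factorial_X2 F_def[symmetric]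
      by (intro degree_add_le degree_pcompose_le[THEN order_trans]) (auto simp: F)
    have "coeff (f q) (2 * q) = 1"
      unfolding f_def falling_factorial_X2 F_def[symmetric] using that
      by (simp add: coeff_pcompose_X2 F coeff_eq_0)
    then show "2 * q \<le> degree (f q)"
      by (intro le_degree) simp
  qed
  have coeffs: "codegree_coeff (2 * q) (f q) r = poly (\<phi> r) (real q) + codegree_coeff (2 * q) (F q) r"
    for q r
  proof -
    have "codegree_coeff (2 * q) (f q) r =
        codegree_coeff (2 * q) (falling_factorial ([:0, 1:] ^ 2) q) r + codegree_coeff (2 * q) (F q) r"
      by (simp add: codegree_coeff_def f_def)
    then show ?thesis
      unfolding codegree_coeff_falling_factorial_X2 F_def[symmetric] P by (simp add: \<phi>_def)
  qed
  have "two_level_polynomial_exact f [:0, 2:] (\<lambda>q. ereal (real q - 1 - real 0))"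
  proof (rule two_level_polynomial_exactI[where \<phi> = \<phi>])
    show "f q \<noteq> 0 \<and> real (degree (f q)) = poly [:0, 2:] (real q)" if "q \<ge> 1" for q
      using deg[OF that] that by auto
    \<comment> \<open>For \<open>r < q\<close> the exponent \<open>2q - r\<close> exceeds the degree
      \<open>q\<close> of \<open>F q\<close>. At \<open>r = q\<close>, the failure case below, it
      hits the leading coefficient 1.\<close>
    show "codegree_coeff (degree (f q)) (f q) r = poly (\<phi> r) (real q)" if "r + 0 < q" for q r
      using that by (simp add: deg coeffs) (simp add: codegree_coeff_def coeff_eq_0 F)
    show "codegree_coeff (degree (f q)) (f q) (q - 0) \<noteq> poly (\<phi> (q - 0)) (real q)" if "q \<ge> 1" for q
      using that by (simp add: deg coeffs) (simp add: codegree_coeff_def F)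
  qed simp
  then show ?thesis
    by (simp add: f_def[abs_def] F_def)
qed

theorem proposition3p7:
  shows "((\<forall>q\<ge>1. \<forall>n. hom_count (star_graph q) (star_graph n) = n ^ q + n) \<and>
         two_level_polynomial_exact
           (\<lambda>q. [:0, 1:] ^ q + [:0, 1:]) [:0, 1:] (\<lambda>q. ereal (real q - 2))) \<and>
         ((\<forall>q\<ge>1. \<forall>n.
            int (hom_count (complete_graph q)
                   (disjoint_union (complete_graph (n ^ 2)) (complete_graph n))) =
            falling_factorial (int n ^ 2) q + falling_factorial (int n) q) \<and>
         two_level_polynomial_exact
           (\<lambda>q. falling_factorial ([:0, 1:] ^ 2) q + falling_factorial [:0, 1:] q)
           [:0, 2:] (\<lambda>q. ereal (real q - 1)))"
  using hom_count_star_graph two_level_polynomial_exact_star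
    hom_count_complete_graph_disjoint_union two_level_polynomial_exact_complete
  by simp

end
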